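(* Let $(X,\sigma)$ be a subshift with $h_{\mathrm{top}}(\sigma)=0$. Let $G$ be a group and suppose that some element $g\in G$ has exponential distortion. If $\Phi\colon G\to \mathrm{Aut}(X)$ is a group homomorphism, then the element $\Phi(g)\in\mathrm{Aut}(X)$ has finite order. Moreover, if $G$ is almost simple, then $\Phi(G)$ is a finite group.
   Context: Let $\Sigma$ be a finite alphabet with the discrete topology and give $\Sigma^{\mathbb Z}$ the product topology. The left shift $\sigma\colon\Sigma^{\mathbb Z}\to\Sigma^{\mathbb Z}$ is $(\sigma x)[n]=x[n+1]$. A subshift $(X,\sigma)$ is a closed set $X\subset\Sigma^{\mathbb Z}$ invariant under $\sigma$. $\mathrm{Aut}(X)$ is the group (under composition) of homeomorphisms $\phi\colon X\to X$ with $\phi\circ\sigma=\sigma\circ\phi$. The complexity $P_X(n)$ is the number of words of length $n$ that occur in elements of $X$, and $h_{\mathrm{top}}(\sigma)=\lim_{n\to\infty}\frac{\log P_X(n)}{n}$. An element $g$ of a group $G$ has exponential distortion if it has infinite order and there exist a finite set $S\subset G$ with $g\in\langle S\rangle$ and a constant $C>0$ such that $\ell_S(g^m)\le C\log(m)$ for all sufficiently large $m$, where $\ell_S$ denotes word length in the group $\langle S\rangle$ with respect to the generating set $S$ (and inverses of its elements). A group $G$ is almost simple if every normal subgroup of $G$ is either finite or has finite index. *)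

theory Defs
  imports "HOL-Analysis.Function_Topology" "HOL-Algebra.Bij" "HOL-Algebra.Generated_Groups"
    "HOL-Algebra.Multiplicative_Group"
begin

definition full_shift_topology :: "'a set \<Rightarrow> (int \<Rightarrow> 'a) topology" where
  "full_shift_topology A = product_topology (\<lambda>_. discrete_topology A) UNIV"

definition shift :: "(int \<Rightarrow> 'a) \<Rightarrow> (int \<Rightarrow> 'a)" where
  "shift x = (\<lambda>n. x (n + 1))"

(* The shift is invertible on the full shift; invariance of X means equality, so that
   the shift restricts to a homeomorphism of X.  The empty subshift is allowed. *)
definition subshift :: "'a set \<Rightarrow> (int \<Rightarrow> 'a) set \<Rightarrow> bool" where
  "subshift A X \<longleftrightarrow> closedin (full_shift_topology A) X \<and> shift ` X = X"

definition complexity :: "(int \<Rightarrow> 'a) set \<Rightarrow> nat \<Rightarrow> nat" where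
  "complexity X n = card {map (\<lambda>j. x (i + int j)) [0..<n] | x i. x \<in> X}"

(* For subshifts over a finite alphabet the limit exists by subadditivity. *)
definition topological_entropy :: "(int \<Rightarrow> 'a) set \<Rightarrow> real" where
  "topological_entropy X = lim (\<lambda>n. ln (real (complexity X n)) / real n)"

(* Elements are maps X to X, made unique as HOL functions by being undefined outside X
   (as in Bij). *)
definition shift_automorphisms ::
    "'a set \<Rightarrow> (int \<Rightarrow> 'a) set \<Rightarrow> ((int \<Rightarrow> 'a) \<Rightarrow> (int \<Rightarrow> 'a)) set" where
  "shift_automorphisms A X = {\<phi> \<in> extensional X.
     homeomorphic_map (subtopology (full_shift_topology A) X)
                      (subtopology (full_shift_topology A) X) \<phi> \<and>
     (\<forall>x\<in>X. \<phi> (shift x) = shift (\<phi> x))}"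

definition shift_Aut ::
    "'a set \<Rightarrow> (int \<Rightarrow> 'a) set \<Rightarrow> ((int \<Rightarrow> 'a) \<Rightarrow> (int \<Rightarrow> 'a)) monoid" where
  "shift_Aut A X = (BijGroup X)\<lparr>carrier := shift_automorphisms A X\<rparr>"

lemma topspace_subshift:
  assumes "subshift A X"
  shows "topspace (subtopology (full_shift_topology A) X) = X"
  using assms closedin_subset[of "full_shift_topology A" X]
  by (auto simp: subshift_def)

lemma group_shift_Aut:
  assumes "subshift A X"
  shows "group (shift_Aut A X)"
proof -
  let ?T = "subtopology (full_shift_topology A) X"
  have top: "topspace ?T = X" using topspace_subshift[OF assms] .
  have sh: "shift x \<in> X" if "x \<in> X" for x
    using assms that by (auto simp: subshift_def)
  have sub: "shift_automorphisms A X \<subseteq> Bij X"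
  proof
    fix f assume f: "f \<in> shift_automorphisms A X"
    then have "quotient_map ?T ?T f" "inj_on f (topspace ?T)"
      by (auto simp: shift_automorphisms_def homeomorphic_map_def)
    then have "f ` X = X" "inj_on f X"
      using quotient_imp_surjective_map[of ?T ?T f] unfolding top by auto
    then show "f \<in> Bij X"
      using f by (auto simp: shift_automorphisms_def Bij_def bij_betw_def)
  qed
  interpret B: group "BijGroup X" by (rule group_BijGroup)
  have one: "(\<lambda>x\<in>X. x) \<in> shift_automorphisms A X"
  proof -
    have "homeomorphic_map ?T ?T (\<lambda>x\<in>X. x)"
      by (rule homeomorphic_map_eq[of _ _ id]) (auto simp: top)
    then show ?thesis using sh by (auto simp: shift_automorphisms_def)
  qed
  have mult: "compose X f g \<in> shift_automorphisms A X"
    if f: "f \<in> shift_automorphisms A X" and g: "g \<in> shift_automorphisms A X" for f g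
  proof -
    have gX: "g x \<in> X" if "x \<in> X" for x
      using sub g that by (auto simp: Bij_def bij_betw_def)
    have "homeomorphic_map ?T ?T (f \<circ> g)"
      using f g by (auto simp: shift_automorphisms_def intro: homeomorphic_map_compose)
    then have "homeomorphic_map ?T ?T (compose X f g)"
      by (rule homeomorphic_map_eq) (auto simp: top compose_def)
    then show ?thesis
      using f g gX sh by (auto simp: shift_automorphisms_def compose_def)
  qed
  have inverse: "(\<lambda>x\<in>X. inv_into X f x) \<in> shift_automorphisms A X"
    if f: "f \<in> shift_automorphisms A X" for f
  proof -
    have hf: "homeomorphic_map ?T ?T f" and com: "\<And>x. x \<in> X \<Longrightarrow> f (shift x) = shift (f x)"
      using f by (auto simp: shift_automorphisms_def)
    have bij: "bij_betw f X X" using sub f by (auto simp: Bij_def)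
    obtain g where g: "homeomorphic_maps ?T ?T f g"
      using hf homeomorphic_map_maps by blast
    have geq: "g x = inv_into X f x" if "x \<in> X" for x
    proof -
      have "g x \<in> X" "f (g x) = x"
        using g that top
        by (auto simp: homeomorphic_maps_def continuous_map_def Pi_iff)
      then show ?thesis
        using bij by (metis bij_betw_inv_into_left)
    qed
    have "homeomorphic_map ?T ?T g"
      using g homeomorphic_maps_map by blast
    then have h: "homeomorphic_map ?T ?T (\<lambda>x\<in>X. inv_into X f x)"
      by (rule homeomorphic_map_eq) (auto simp: top geq)
    have "inv_into X f (shift x) = shift (inv_into X f x)" if "x \<in> X" for x
    proof -
      have "inv_into X f x \<in> X" "f (inv_into X f x) = x"
        using bij that by (auto simp: bij_betw_def inv_into_into f_inv_into_f)
      then show ?thesis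
        using com sh bij by (metis bij_betw_inv_into_left)
    qed
    then show ?thesis using h sh by (auto simp: shift_automorphisms_def)
  qed
  have "subgroup (shift_automorphisms A X) (BijGroup X)"
  proof (rule B.subgroupI)
    show "shift_automorphisms A X \<subseteq> carrier (BijGroup X)" using sub by (simp add: BijGroup_def)
    show "shift_automorphisms A X \<noteq> {}" using one by blast
  next
    fix f assume f: "f \<in> shift_automorphisms A X"
    then show "inv\<^bsub>BijGroup X\<^esub> f \<in> shift_automorphisms A X"
      using inverse[OF f] sub by (simp add: inv_BijGroup subset_iff)
  next
    fix f g assume "f \<in> shift_automorphisms A X" "g \<in> shift_automorphisms A X"
    then show "f \<otimes>\<^bsub>BijGroup X\<^esub> g \<in> shift_automorphisms A X"
      using mult sub by (simp add: BijGroup_def subset_iff)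
  qed
  then show ?thesis
    unfolding shift_Aut_def by (rule B.subgroup_imp_group)
qed

(* Only meaningful for x in generate G S, where a representing word exists. *)
definition word_length :: "('g, 'm) monoid_scheme \<Rightarrow> 'g set \<Rightarrow> 'g \<Rightarrow> nat" where
  "word_length G S x = (LEAST n. \<exists>ws. length ws = n \<and> set ws \<subseteq> S \<union> m_inv G ` S \<and>
     foldr (\<lambda>a b. a \<otimes>\<^bsub>G\<^esub> b) ws \<one>\<^bsub>G\<^esub> = x)"

(* In HOL-Algebra, ord is 0 exactly for the elements of infinite order. *)
definition exponential_distortion :: "('g, 'm) monoid_scheme \<Rightarrow> 'g \<Rightarrow> bool" where
  "exponential_distortion G g \<longleftrightarrow> group.ord G g = 0 \<and>
     (\<exists>S. finite S \<and> S \<subseteq> carrier G \<and> g \<in> generate G S \<and>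
        (\<exists>C>0. \<forall>\<^sub>F m in sequentially. real (word_length G S (g [^]\<^bsub>G\<^esub> m)) \<le> C * ln (real m)))"

definition almost_simple :: "('g, 'm) monoid_scheme \<Rightarrow> bool" where
  "almost_simple G \<longleftrightarrow> (\<forall>N. N \<lhd> G \<longrightarrow> finite N \<or> finite (rcosets\<^bsub>G\<^esub> N))"

end

theory Submission
  imports Defs
begin

text \<open>
  Automorphisms are block maps of finite range, and ranges are subadditive under composition, so
  exponential distortion of \<open>g\<close> bounds the range of \<open>\<phi>\<^sup>i = \<Phi>(g)\<^sup>i\<close>, \<open>i < m\<close>, by \<open>O(log m)\<close>. The column word
  \<open>((\<phi>\<^sup>i x)[0])\<close>, \<open>i < m\<close>, is therefore determined by a window of \<open>x\<close> of length \<open>O(log m)\<close>; by zero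
  entropy there are fewer than \<open>m\<close> such column words for large \<open>m\<close>. By the
  Morse--Hedlund argument all columns are then periodic with a common period \<open>p\<close>, and since
  \<open>\<phi>\<close> commutes with the shift, \<open>\<phi>\<^sup>p\<close> is the identity. In the almost simple case the kernel of
  \<open>\<Phi>\<close> contains the infinitely many powers of \<open>g\<^sup>p\<close>, so it has finite index.
\<close>

section \<open>Subadditive sequences and entropy\<close>

lemma subadditive_mult_le:
  fixes a :: "nat \<Rightarrow> real"
  assumes sub: "\<And>m n. a (m + n) \<le> a m + a n" and "a 0 \<le> 0"
  shows "a (q * k) \<le> real q * a k"
proof (induction q)
  case 0
  then show ?case using assms by simp
next
  case (Suc q)
  have "a (Suc q * k) \<le> a k + a (q * k)" using sub[of k "q * k"] by simp
  then show ?case using Suc by (simp add: algebra_simps)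
qed

text \<open>Division with remainder by a near-optimal \<open>k\<close> leaves a bounded remainder
  term, so the quotients converge to their infimum.\<close>

lemma fekete:
  fixes a :: "nat \<Rightarrow> real"
  assumes sub: "\<And>m n. a (m + n) \<le> a m + a n" and nonneg: "\<And>n. 0 \<le> a n" and zero: "a 0 = 0"
  shows "convergent (\<lambda>n. a n / real n)"
proof -
  define L where "L = (INF n\<in>{1..}. a n / real n)"
  have bdd: "bdd_below ((\<lambda>n. a n / real n) ` {1..})"
    by (rule bdd_belowI[of _ 0]) (auto simp: nonneg)
  have lower: "L \<le> a n / real n" if "n \<ge> 1" for n
    unfolding L_def using that bdd by (intro cINF_lower) auto
  have "(\<lambda>n. a n / real n) \<longlonglongrightarrow> L"
  proof (rule LIMSEQ_I)
    fix e :: real assume "e > 0"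
    have "\<exists>k\<in>{1..}. a k / real k < L + e / 2"
      using cINF_less_iff[of "{1..}" "\<lambda>n. a n / real n" "L + e / 2"] bdd \<open>e > 0\<close>
      unfolding L_def by auto
    then obtain k where k: "k \<ge> 1" "a k / real k < L + e / 2" by auto
    \<comment> \<open>A sum of nonnegative terms dominates each of them, so \<open>M\<close> bounds
      every remainder term \<open>a (n mod k)\<close>.\<close>
    define M where "M = (\<Sum>r<k. a r)"
    have M: "a r \<le> M" if "r < k" for r
      unfolding M_def using that by (intro member_le_sum) (auto simp: nonneg)
    obtain n0 :: nat where n0: "n0 > 2 * M / e" using reals_Archimedean2 by blast
    have "norm (a n / real n - L) < e" if n: "n \<ge> max 1 n0" for n
    proof -
      have "a n \<le> a (n div k * k) + a (n mod k)"
        using sub[of "n div k * k" "n mod k"] by simp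
      also have "a (n div k * k) \<le> real (n div k) * a k"
        by (rule subadditive_mult_le) (auto simp: sub zero)
      also have "a (n mod k) \<le> M" using M k by simp
      finally have 1: "a n \<le> real (n div k) * a k + M" by simp
      have "real (n div k) * a k = real (n div k * k) * (a k / real k)"
        using k by simp
      also have "\<dots> \<le> real n * (a k / real k)"
        by (rule mult_right_mono) (auto simp: nonneg simp del: of_nat_mult)
      finally have "a n \<le> real n * (a k / real k) + M" using 1 by simp
      then have "a n / real n \<le> a k / real k + M / real n"
        using n by (simp add: field_simps)
      moreover have "M / real n < e / 2"
      proof -
        have "2 * M / e < real n" using n n0 by linarith
        then show ?thesis using \<open>e > 0\<close> n by (simp add: field_simps)
      qed
      moreover have "L \<le> a n / real n" using n by (intro lower) simp
      ultimately show ?thesis using k unfolding real_norm_def by arith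
    qed
    then show "\<exists>no. \<forall>n\<ge>no. norm (a n / real n - L) < e" by blast
  qed
  then show ?thesis by (rule convergentI)
qed

section \<open>Words of a subshift and their growth\<close>

definition language :: "(int \<Rightarrow> 'a) set \<Rightarrow> nat \<Rightarrow> 'a list set" where
  "language X n = {map (\<lambda>j. x (i + int j)) [0..<n] | x i. x \<in> X}"

lemma complexity_eq_card_language: "complexity X n = card (language X n)"
  by (simp add: complexity_def language_def)

lemma finite_language:
  assumes "finite A" and "X \<subseteq> UNIV \<rightarrow> A"
  shows "finite (language X n)"
proof (rule finite_subset)
  show "language X n \<subseteq> {xs. set xs \<subseteq> A \<and> length xs = n}"
    using subsetD[OF assms(2)] by (auto simp: language_def Pi_iff)
  show "finite {xs. set xs \<subseteq> A \<and> length xs = n}"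
    by (rule finite_lists_length_eq[OF assms(1)])
qed

text \<open>Cutting a word after \<open>m\<close> letters leaves two words of the language, and this
  pair recovers it.\<close>

lemma complexity_submultiplicative:
  assumes "finite A" and X: "X \<subseteq> UNIV \<rightarrow> A"
  shows "complexity X (m + n) \<le> complexity X m * complexity X n"
proof -
  note fin = finite_language[OF assms]
  have "language X (m + n) \<subseteq> (\<lambda>(u, v). u @ v) ` (language X m \<times> language X n)"
  proof
    fix w assume "w \<in> language X (m + n)"
    then obtain x i where x: "x \<in> X" and w: "w = map (\<lambda>j. x (i + int j)) [0..<m + n]"
      by (auto simp: language_def)
    have "w = map (\<lambda>j. x (i + int j)) [0..<m] @ map (\<lambda>j. x ((i + int m) + int j)) [0..<n]"
      unfolding w by (rule nth_equalityI) (auto simp: nth_append algebra_simps)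
    then show "w \<in> (\<lambda>(u, v). u @ v) ` (language X m \<times> language X n)"
      using x by (force simp: language_def)
  qed
  then have "card (language X (m + n)) \<le> card (language X m \<times> language X n)"
    by (intro surj_card_le) (auto simp: fin)
  then show ?thesis
    by (simp add: card_cartesian_product complexity_eq_card_language)
qed

text \<open>Logarithms turn submultiplicativity into the subadditivity of Fekete's lemma. A nonempty
  \<open>X\<close> keeps the complexity positive, so that \<open>ln\<close> and \<open>exp\<close>
  cancel.\<close>

lemma zero_entropy_complexity:
  assumes "finite A" and X: "X \<subseteq> UNIV \<rightarrow> A" and ne: "X \<noteq> {}"
    and ent: "topological_entropy X = 0" and "e > 0"
  shows "\<forall>\<^sub>F n in sequentially. real (complexity X n) \<le> exp (e * real n)"
proof -
  have pos: "complexity X n > 0" for n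
    using finite_language[OF assms(1) X, of n] ne
    by (auto simp: complexity_eq_card_language card_gt_0_iff) (auto simp: language_def)
  define a where "a n = ln (real (complexity X n))" for n
  have "language X 0 = {[]}" using ne by (auto simp: language_def)
  then have a0: "a 0 = 0" by (simp add: a_def complexity_eq_card_language)
  \<comment> \<open>Without convergence the value of \<open>lim\<close> in the entropy would carry no information.\<close>
  have "convergent (\<lambda>n. a n / real n)"
  proof (rule fekete)
    fix m n
    have "real (complexity X (m + n)) \<le> real (complexity X m) * real (complexity X n)"
      using complexity_submultiplicative[OF assms(1) X, of m n]
      by (metis of_nat_le_iff of_nat_mult)
    then have "a (m + n) \<le> ln (real (complexity X m) * real (complexity X n))"
      unfolding a_def using pos by (subst ln_le_cancel_iff) auto
    then show "a (m + n) \<le> a m + a n"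
      unfolding a_def using pos by (simp add: ln_mult)
  next
    show "0 \<le> a n" for n using pos[of n] by (simp add: a_def)
  next
    show "a 0 = 0" by (rule a0)
  qed
  then have "(\<lambda>n. a n / real n) \<longlonglongrightarrow> 0"
    using ent by (simp add: convergent_LIMSEQ_iff topological_entropy_def a_def)
  then have "\<forall>\<^sub>F n in sequentially. a n / real n < e"
    using \<open>e > 0\<close> by (rule order_tendstoD)
  then show ?thesis
  proof (eventually_elim)
    case (elim n)
    \<comment> \<open>At \<open>n = 0\<close> the quotient is 0 by the convention on division by
      zero and says nothing about \<open>a 0\<close>.\<close>
    have "a n \<le> e * real n"
    proof (cases "n = 0")
      case True
      then show ?thesis using a0 by simp
    next
      case False
      then show ?thesis using elim by (simp add: field_simps)
    qed
    then have "exp (a n) \<le> exp (e * real n)" by simp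
    then show ?case unfolding a_def using pos[of n] by simp
  qed
qed

section \<open>Range of a map\<close>

text \<open>The radius of a sliding block code, required at every coordinate separately, so that it
  makes sense for maps not known to commute with the shift.\<close>

definition has_range :: "(int \<Rightarrow> 'a) set \<Rightarrow> nat \<Rightarrow> ((int \<Rightarrow> 'a) \<Rightarrow> (int \<Rightarrow> 'a)) \<Rightarrow> bool" where
  "has_range X N f \<longleftrightarrow>
     (\<forall>x\<in>X. \<forall>y\<in>X. \<forall>k. (\<forall>i. \<bar>i - k\<bar> \<le> int N \<longrightarrow> x i = y i) \<longrightarrow> f x k = f y k)"

lemma has_range_mono: "has_range X M f \<Longrightarrow> M \<le> N \<Longrightarrow> has_range X N f"
  unfolding has_range_def by (meson of_nat_le_iff order_trans)

lemma has_range_cong: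
  "(\<And>x. x \<in> X \<Longrightarrow> f x = h x) \<Longrightarrow> has_range X N f \<longleftrightarrow> has_range X N h"
  unfolding has_range_def by simp

text \<open>Coordinate \<open>k\<close> of \<open>f (g x)\<close> needs \<open>g x\<close> within
  \<open>M\<close> of \<open>k\<close>, and each of those coordinates needs \<open>x\<close> within
  a further \<open>N\<close>.\<close>

lemma has_range_compose:
  assumes f: "has_range X M f" and g: "has_range X N g" and gX: "g \<in> X \<rightarrow> X"
  shows "has_range X (M + N) (compose X f g)"
  unfolding has_range_def
proof (intro ballI allI impI)
  fix x y k assume xy: "x \<in> X" "y \<in> X" and eq: "\<forall>i. \<bar>i - k\<bar> \<le> int (M + N) \<longrightarrow> x i = y i"
  have "g x i = g y i" if i: "\<bar>i - k\<bar> \<le> int M" for i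
  proof -
    have "x j = y j" if "\<bar>j - i\<bar> \<le> int N" for j
    proof -
      have "\<bar>j - k\<bar> \<le> int (M + N)" using i that by linarith
      then show ?thesis using eq by blast
    qed
    then show ?thesis using g xy unfolding has_range_def by blast
  qed
  moreover have "g x \<in> X" "g y \<in> X" using gX xy by auto
  ultimately have "f (g x) k = f (g y) k" using f unfolding has_range_def by blast
  then show "compose X f g x k = compose X f g y k" using xy by (simp add: compose_def)
qed

section \<open>Shift equivariance and the Curtis-Hedlund-Lyndon theorem\<close>

definition translate :: "int \<Rightarrow> (int \<Rightarrow> 'a) \<Rightarrow> (int \<Rightarrow> 'a)" where
  "translate k x = (\<lambda>n. x (n + k))"

lemma translate_mem_commute:
  fixes f :: "(int \<Rightarrow> 'a) \<Rightarrow> (int \<Rightarrow> 'a)"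
  assumes inv: "shift ` X = X" and com: "\<And>x. x \<in> X \<Longrightarrow> f (shift x) = shift (f x)"
    and "x \<in> X"
  shows "translate k x \<in> X \<and> f (translate k x) = translate k (f x)"
proof (induction k rule: int_induct[where k = 0])
  case base
  then show ?case using \<open>x \<in> X\<close> by (simp add: translate_def)
next
  case (step1 i)
  have "translate (i + 1) y = shift (translate i y)" for y :: "int \<Rightarrow> 'a"
    by (auto simp: translate_def shift_def algebra_simps)
  then show ?case using step1 com[of "translate i x"] inv by auto
next
  case (step2 i)
  have *: "translate i y = shift (translate (i - 1) y)" for y :: "int \<Rightarrow> 'a"
    by (auto simp: translate_def shift_def algebra_simps)
  have shift_inj: "u = v" if "shift u = shift v" for u v :: "int \<Rightarrow> 'a"
  proof
    fix n show "u n = v n" using fun_cong[OF that, of "n - 1"] by (simp add: shift_def)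
  qed
  \<comment> \<open>In the downward step, a shift preimage of \<open>translate i x\<close> exists in
    \<open>X\<close> and, the shift being injective, can only be
    \<open>translate (i - 1) x\<close>.\<close>
  obtain y where y: "y \<in> X" "translate i x = shift y"
    using step2 inv by (metis imageE)
  then have "translate (i - 1) x = y" using * shift_inj by metis
  then show ?case using y step2 com * shift_inj by metis
qed

lemma subshift_subset_alphabet: "subshift A X \<Longrightarrow> X \<subseteq> UNIV \<rightarrow> A"
  using closedin_subset[of "full_shift_topology A" X]
  by (auto simp: subshift_def full_shift_topology_def PiE_iff)

lemma openin_cylinder:
  assumes "finite I"
  shows "openin (full_shift_topology A) {y. (\<forall>i. y i \<in> A) \<and> (\<forall>i\<in>I. y i = x i)}"
proof -
  have "{y. (\<forall>i. y i \<in> A) \<and> (\<forall>i\<in>I. y i = x i)}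
      = (\<Pi>\<^sub>E i\<in>UNIV. if i \<in> I then A \<inter> {x i} else A)"
    by (fastforce simp: PiE_iff split: if_splits)
  moreover have "finite {i. (if i \<in> I then A \<inter> {x i} else A) \<noteq> A}"
    by (rule finite_subset[OF _ assms]) auto
  ultimately show ?thesis
    unfolding full_shift_topology_def
    by (auto simp: openin_PiE_gen)
qed

text \<open>One half of the Curtis-Hedlund-Lyndon theorem: by continuity coordinate 0 of the image
  depends locally on a finite window, compactness makes the window uniform, and commuting with the
  shift carries it to all coordinates.\<close>

lemma shift_automorphism_has_range:
  assumes "finite A" and sub: "subshift A X" and f: "f \<in> shift_automorphisms A X"
  shows "\<exists>N. has_range X N f"
proof -
  let ?T = "full_shift_topology A"
  have XA: "x i \<in> A" if "x \<in> X" for x i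
    using subshift_subset_alphabet[OF sub] that by auto
  have inv: "shift ` X = X" using sub by (simp add: subshift_def)
  have com: "f (shift x) = shift (f x)" if "x \<in> X" for x
    using f that by (auto simp: shift_automorphisms_def)
  have "continuous_map (subtopology ?T X) ?T f"
    using f unfolding shift_automorphisms_def
    by (auto dest: homeomorphic_imp_continuous_map continuous_map_into_fulltopology)
  then have cont: "continuous_map (subtopology ?T X) (discrete_topology A) (\<lambda>x. f x 0)"
    unfolding full_shift_topology_def by (auto simp: continuous_map_componentwise_UNIV)
  have compact: "compactin ?T X"
  proof -
    have "compact_space ?T"
      unfolding full_shift_topology_def
      using \<open>finite A\<close>
      by (auto simp: compact_space_product_topology compact_space_discrete_topology)
    then show ?thesis using sub closedin_compact_space unfolding subshift_def by blast
  qed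
  have "\<exists>N. \<forall>y\<in>X. (\<forall>i\<in>{-int N..int N}. y i = x i) \<longrightarrow> f y 0 = f x 0" if x: "x \<in> X" for x
  proof -
    have top: "topspace (subtopology ?T X) = X" using topspace_subshift[OF sub] .
    have "f x 0 \<in> A" using cont x unfolding continuous_map_def top by auto
    then have "openin (subtopology ?T X) {y \<in> X. f y 0 \<in> {f x 0}}"
      using openin_continuous_map_preimage[OF cont, of "{f x 0}"] unfolding top by auto
    then obtain U where U: "openin ?T U" "{y \<in> X. f y 0 \<in> {f x 0}} = U \<inter> X"
      unfolding openin_subtopology by blast
    have "x \<in> U" using U x by blast
    then obtain V where V: "finite {i. V i \<noteq> A}" "x \<in> Pi\<^sub>E UNIV V" "Pi\<^sub>E UNIV V \<subseteq> U"
      using product_topology_open_contains_basis[OF U(1)[unfolded full_shift_topology_def] \<open>x \<in> U\<close>]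
      by auto
    \<comment> \<open>Only finitely many factors of the basic open box differ from \<open>A\<close>;
      \<open>N\<close> bounds their positions.\<close>
    obtain N where N: "\<And>i. V i \<noteq> A \<Longrightarrow> \<bar>i\<bar> \<le> int N"
    proof -
      obtain N where "\<forall>j \<in> (\<lambda>i. nat \<bar>i\<bar>) ` {i. V i \<noteq> A}. j \<le> N"
        using V(1) finite_nat_set_iff_bounded_le by blast
      then have "\<bar>i\<bar> \<le> int N" if "V i \<noteq> A" for i using that by force
      then show ?thesis using that by blast
    qed
    have "f y 0 = f x 0" if y: "y \<in> X" and eq: "\<forall>i\<in>{-int N..int N}. y i = x i" for y
    proof -
      have "y i \<in> V i" for i
      proof (cases "V i = A")
        case False
        then have "\<bar>i\<bar> \<le> int N" by (rule N)
        then have "i \<in> {-int N..int N}" by auto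
        then have "y i = x i" using eq by blast
        then show ?thesis using V(2) by auto
      qed (use XA y in simp)
      then show ?thesis using V(3) U(2) y by auto
    qed
    then show ?thesis by blast
  qed
  then obtain N where
    N: "\<And>x y. x \<in> X \<Longrightarrow> y \<in> X \<Longrightarrow> \<forall>i\<in>{-int (N x)..int (N x)}. y i = x i \<Longrightarrow> f y 0 = f x 0"
    by metis
  \<comment> \<open>Each cylinder uses the window of its own centre, so coordinate 0 of the image is
    constant on its points in \<open>X\<close>.\<close>
  define cyl where "cyl x = {y. (\<forall>i. y i \<in> A) \<and> (\<forall>i\<in>{-int (N x)..int (N x)}. y i = x i)}" for x
  have "\<exists>F. finite F \<and> F \<subseteq> cyl ` X \<and> X \<subseteq> \<Union>F"
    using compact unfolding compactin_def
    by (elim conjE allE[of _ "cyl ` X"])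
       (auto simp: cyl_def openin_cylinder XA)
  then obtain F where F: "finite F" "F \<subseteq> X" "X \<subseteq> \<Union>(cyl ` F)"
    by (metis finite_subset_image)
  obtain M where M: "\<And>x. x \<in> F \<Longrightarrow> N x \<le> M"
    using F(1) finite_nat_set_iff_bounded_le[of "N ` F"] by auto
  \<comment> \<open>Agreement on the largest window puts \<open>z\<close> in the same cylinder as
    \<open>y\<close>, so both are compared with its centre \<open>x\<close>.\<close>
  have base: "f y 0 = f z 0" if yz: "y \<in> X" "z \<in> X" "\<And>i. \<bar>i\<bar> \<le> int M \<Longrightarrow> y i = z i" for y z
  proof -
    obtain x where x: "x \<in> F" "y \<in> cyl x" using F yz by auto
    have "f y 0 = f x 0" using N[of x y] x F yz by (auto simp: cyl_def)
    moreover have "z i = x i" if "i \<in> {-int (N x)..int (N x)}" for i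
    proof -
      have "y i = z i" using M[OF x(1)] that yz(3)[of i] by auto
      moreover have "y i = x i" using x(2) that by (auto simp: cyl_def)
      ultimately show ?thesis by simp
    qed
    then have "f z 0 = f x 0" using N[of x z] x F yz by auto
    ultimately show ?thesis by simp
  qed
  have "has_range X M f"
    unfolding has_range_def
  proof (intro ballI allI impI)
    fix x y k assume xy: "x \<in> X" "y \<in> X" and eq: "\<forall>i. \<bar>i - k\<bar> \<le> int M \<longrightarrow> x i = y i"
    have "f (translate k x) 0 = f (translate k y) 0"
      using translate_mem_commute[of X f, OF inv com] xy eq
      by (intro base) (auto simp: translate_def)
    then show "f x k = f y k"
      using translate_mem_commute[of X f, OF inv com] xy by (auto simp: translate_def)
  qed
  then show ?thesis ..
qed

section \<open>Column words\<close>

text \<open>The vertical word at coordinate 0 in the space-time diagram of \<open>f\<close>, whose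
  row \<open>i\<close> is \<open>(f ^^ i) x\<close>.\<close>

definition column :: "((int \<Rightarrow> 'a) \<Rightarrow> (int \<Rightarrow> 'a)) \<Rightarrow> nat \<Rightarrow> (int \<Rightarrow> 'a) \<Rightarrow> 'a list" where
  "column f m x = map (\<lambda>i. (f ^^ i) x 0) [0..<m]"

lemma column_eq_iff: "column f m x = column f m y \<longleftrightarrow> (\<forall>i<m. (f ^^ i) x 0 = (f ^^ i) y 0)"
  by (auto simp: column_def)

lemma funpow_mem: "f \<in> X \<rightarrow> X \<Longrightarrow> x \<in> X \<Longrightarrow> (f ^^ i) x \<in> X"
  by (induction i) auto

text \<open>The window of radius \<open>N\<close> around 0, a word of length
  \<open>2 * N + 1\<close>, determines the whole column.\<close>

lemma card_columns_le_complexity: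
  assumes "finite A" and XA: "X \<subseteq> UNIV \<rightarrow> A"
    and range: "\<And>i. i < m \<Longrightarrow> has_range X N (f ^^ i)"
  shows "card (column f m ` X) \<le> complexity X (2 * N + 1)"
proof -
  define w where "w x = map (\<lambda>j. x (- int N + int j)) [0..<2 * N + 1]" for x :: "int \<Rightarrow> 'a"
  have w: "w ` X \<subseteq> language X (2 * N + 1)"
    unfolding w_def language_def by blast
  have fin: "finite (w ` X)"
    using finite_subset[OF w finite_language[OF assms(1) XA]] .
  have "column f m x = column f m y" if xy: "x \<in> X" "y \<in> X" "w x = w y" for x y
  proof -
    have eq: "x i = y i" if "\<bar>i\<bar> \<le> int N" for i
    proof -
      have "nat (i + int N) < 2 * N + 1" using that by linarith
      moreover have "w x ! nat (i + int N) = w y ! nat (i + int N)" using xy by simp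
      moreover have "int (nat (i + int N)) = i + int N" using that by linarith
      ultimately show ?thesis by (simp add: w_def del: upt_Suc int_nat_eq)
    qed
    show ?thesis unfolding column_eq_iff
    proof (intro allI impI)
      fix i assume "i < m"
      have "\<forall>j. \<bar>j - 0\<bar> \<le> int N \<longrightarrow> x j = y j" using eq by simp
      then show "(f ^^ i) x 0 = (f ^^ i) y 0"
        using range[OF \<open>i < m\<close>] xy(1,2) unfolding has_range_def by blast
    qed
  qed
  \<comment> \<open>Choosing a representative of each window turns this dependence into a function
    on words.\<close>
  then have "column f m x = column f m (SOME y. y \<in> X \<and> w y = w x)" if "x \<in> X" for x
    using someI[of "\<lambda>y. y \<in> X \<and> w y = w x" x] that by metis
  then have "column f m ` X \<subseteq> (\<lambda>v. column f m (SOME y. y \<in> X \<and> w y = v)) ` w ` X"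
    by auto
  then have "card (column f m ` X) \<le> card (w ` X)"
    by (rule surj_card_le[OF fin])
  also have "\<dots> \<le> card (language X (2 * N + 1))"
    by (rule card_mono[OF finite_language[OF assms(1) XA] w])
  finally show ?thesis by (simp add: complexity_def language_def)
qed

text \<open>For \<open>i \<ge> k\<close>, entry \<open>i\<close> is entry \<open>k\<close> of the
  orbit started at time \<open>i - k\<close>, whose first \<open>k\<close> entries agree by
  induction.\<close>

lemma columns_determined:
  assumes fX: "f \<in> X \<rightarrow> X"
    and step: "\<And>x y. x \<in> X \<Longrightarrow> y \<in> X \<Longrightarrow> column f k x = column f k y \<Longrightarrow> (f ^^ k) x 0 = (f ^^ k) y 0"
    and xy: "x \<in> X" "y \<in> X" "column f k x = column f k y"
  shows "(f ^^ i) x 0 = (f ^^ i) y 0"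
proof (induction i rule: less_induct)
  case (less i)
  show ?case
  proof (cases "i < k")
    case True
    then show ?thesis using xy by (auto simp: column_eq_iff)
  next
    case False
    have shifted: "(f ^^ j) ((f ^^ (i - k)) z) = (f ^^ (j + (i - k))) z" for j z
      by (simp add: funpow_add)
    have "(f ^^ k) ((f ^^ (i - k)) x) 0 = (f ^^ k) ((f ^^ (i - k)) y) 0"
      using xy fX less False
      by (intro step) (auto simp: column_eq_iff shifted intro!: funpow_mem)
    then show ?thesis using False by (simp add: shifted)
  qed
qed

text \<open>The Morse--Hedlund argument: the number of columns cannot grow at every step.\<close>

lemma few_columns_imp_determined:
  assumes "finite A" and XA: "X \<subseteq> UNIV \<rightarrow> A" and fX: "f \<in> X \<rightarrow> X"
    and small: "card (column f m ` X) < m"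
  obtains k where "\<And>x y i. x \<in> X \<Longrightarrow> y \<in> X \<Longrightarrow> column f k x = column f k y \<Longrightarrow>
    (f ^^ i) x 0 = (f ^^ i) y 0"
proof -
  define p where "p n = card (column f n ` X)" for n
  have take: "take n (column f (Suc n) x) = column f n x" for n x
    by (simp add: column_def take_map)
  have fin: "finite (column f n ` X)" for n
  proof (rule finite_subset)
    show "column f n ` X \<subseteq> {xs. set xs \<subseteq> A \<and> length xs = n}"
      using subsetD[OF XA funpow_mem[OF fX]] by (auto simp: column_def Pi_iff)
    show "finite {xs. set xs \<subseteq> A \<and> length xs = n}"
      by (rule finite_lists_length_eq[OF assms(1)])
  qed
  have img: "take n ` column f (Suc n) ` X = column f n ` X" for n
    by (simp add: image_image take)
  have mono: "p n \<le> p (Suc n)" for n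
    unfolding p_def using card_image_le[OF fin[of "Suc n"], of "take n"] img by simp
  \<comment> \<open>Strict growth at every step would give \<open>n \<le> p n\<close> for all
    \<open>n\<close>, which is false at \<open>n = m\<close>.\<close>
  have "\<exists>k. p (Suc k) = p k"
  proof (rule ccontr)
    assume "\<nexists>k. p (Suc k) = p k"
    then have less: "p k < p (Suc k)" for k using mono[of k] by (metis le_neq_implies_less)
    have "n \<le> p n" for n
    proof (induction n)
      case (Suc n)
      then show ?case using less[of n] by simp
    qed simp
    then show False using small unfolding p_def by (meson not_le)
  qed
  then obtain k where k: "p (Suc k) = p k" ..
  \<comment> \<open>A surjection between finite sets of equal size is injective: the first
    \<open>k\<close> entries determine entry \<open>k\<close>, counted from 0.\<close>
  have "inj_on (take k) (column f (Suc k) ` X)"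
    using k fin img unfolding p_def by (intro eq_card_imp_inj_on) auto
  then have "(f ^^ k) x 0 = (f ^^ k) y 0"
    if "x \<in> X" "y \<in> X" "column f k x = column f k y" for x y
    using that take[of k] unfolding inj_on_def by (metis column_eq_iff image_eqI lessI)
  then show ?thesis using that columns_determined[OF fX] by blast
qed

text \<open>Every entry is a function of the first \<open>k\<close>, and there are finitely many
  such functions, so two times share one for all points at once. This makes the period independent
  of the point.\<close>

lemma few_columns_imp_periodic:
  assumes "finite A" and XA: "X \<subseteq> UNIV \<rightarrow> A" and fX: "f ` X = X"
    and small: "card (column f m ` X) < m"
  shows "\<exists>p>0. \<forall>x\<in>X. (f ^^ p) x 0 = x 0"
proof -
  have maps: "f \<in> X \<rightarrow> X" using fX by auto
  obtain k where k: "\<And>x y i. x \<in> X \<Longrightarrow> y \<in> X \<Longrightarrow> column f k x = column f k y \<Longrightarrow>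
    (f ^^ i) x 0 = (f ^^ i) y 0"
    using few_columns_imp_determined[OF assms(1) XA maps small] by metis
  \<comment> \<open>By the choice of \<open>k\<close>, \<open>D i\<close> is the graph of the
    function that reads entry \<open>i\<close> off the first \<open>k\<close> entries.\<close>
  define D where "D i = (\<lambda>x. (column f k x, (f ^^ i) x 0)) ` X" for i
  define W where "W = {xs. set xs \<subseteq> A \<and> length xs = k}"
  have "finite W" unfolding W_def by (rule finite_lists_length_eq[OF assms(1)])
  have "range D \<subseteq> Pow (W \<times> A)"
    using subsetD[OF XA funpow_mem[OF maps]] by (auto simp: D_def W_def column_def Pi_iff)
  then have "finite (range D)"
    by (rule finite_subset) (simp add: \<open>finite W\<close> \<open>finite A\<close>)
  then have "\<not> inj D" using finite_imageD infinite_UNIV_nat by blast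
  then obtain i j where ij: "i < j" "D i = D j"
    unfolding inj_on_def by (metis linorder_neqE_nat)
  have eq: "(f ^^ i) x 0 = (f ^^ j) x 0" if x: "x \<in> X" for x
  proof -
    have "(column f k x, (f ^^ i) x 0) \<in> D i" unfolding D_def using x by (rule imageI)
    then have "(column f k x, (f ^^ i) x 0) \<in> D j" by (simp only: ij(2))
    then obtain y where "y \<in> X" "column f k x = column f k y" "(f ^^ i) x 0 = (f ^^ j) y 0"
      unfolding D_def by auto
    then show ?thesis using k[of x y j] x by simp
  qed
  \<comment> \<open>Every point is an image under \<open>f ^^ i\<close>, so equality of times
    \<open>i\<close> and \<open>j\<close> yields the period \<open>j - i\<close> without a
    preperiod.\<close>
  have surj: "(f ^^ i) ` X = X"
    by (induction i) (simp_all add: fX flip: image_image image_comp)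
  have "(f ^^ (j - i)) y 0 = y 0" if y: "y \<in> X" for y
  proof -
    obtain x where x: "x \<in> X" "y = (f ^^ i) x" using y surj by blast
    have "(f ^^ (j - i)) y = (f ^^ j) x"
      using ij(1) x funpow_add[of "j - i" i f] by simp
    then show ?thesis using eq[OF x(1)] x(2) by simp
  qed
  then show ?thesis using ij(1) by (intro exI[of _ "j - i"]) auto
qed

section \<open>Word length\<close>

lemma (in group) foldr_mult_append:
  assumes "set us \<subseteq> carrier G" "set vs \<subseteq> carrier G"
  shows "foldr (\<otimes>) (us @ vs) \<one> = foldr (\<otimes>) us \<one> \<otimes> foldr (\<otimes>) vs \<one>"
proof -
  have closed: "foldr (\<otimes>) ws \<one> \<in> carrier G" if "set ws \<subseteq> carrier G" for ws
    using that by (induction ws) auto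
  show ?thesis
    using assms closed by (induction us) (auto simp: m_assoc)
qed

text \<open>Concatenation of words follows the inductive definition of \<open>generate\<close>.
  Existence of a word makes the \<open>LEAST\<close> in \<open>word_length\<close> an attained
  minimum.\<close>

lemma (in group) word_length_representation:
  assumes S: "S \<subseteq> carrier G" and x: "x \<in> generate G S"
  obtains ws where "length ws = word_length G S x" "set ws \<subseteq> S \<union> m_inv G ` S"
    "foldr (\<otimes>) ws \<one> = x"
proof -
  have carr: "S \<union> m_inv G ` S \<subseteq> carrier G" using S by auto
  have "\<exists>ws. set ws \<subseteq> S \<union> m_inv G ` S \<and> foldr (\<otimes>) ws \<one> = x"
    using x
  proof (induction rule: generate.induct)
    case one
    then show ?case by (intro exI[of _ "[]"]) auto
  next
    case (incl h)
    then show ?case using S by (intro exI[of _ "[h]"]) auto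
  next
    case (inv h)
    then show ?case using S by (intro exI[of _ "[m_inv G h]"]) auto
  next
    case (eng h1 h2)
    then obtain us vs where "set us \<subseteq> S \<union> m_inv G ` S" "foldr (\<otimes>) us \<one> = h1"
      "set vs \<subseteq> S \<union> m_inv G ` S" "foldr (\<otimes>) vs \<one> = h2" by blast
    then show ?case
      using carr by (intro exI[of _ "us @ vs"]) (subst foldr_mult_append; auto)
  qed
  then have "\<exists>n ws. length ws = n \<and> set ws \<subseteq> S \<union> m_inv G ` S \<and> foldr (\<otimes>) ws \<one> = x" by blast
  from LeastI_ex[OF this] show ?thesis using that unfolding word_length_def by blast
qed

section \<open>Distorted automorphisms\<close>

lemma one_shift_Aut: "\<one>\<^bsub>shift_Aut A X\<^esub> = (\<lambda>x\<in>X. x)"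
  by (simp add: shift_Aut_def BijGroup_def)

lemma has_range_one: "has_range X 0 \<one>\<^bsub>shift_Aut A X\<^esub>"
  unfolding has_range_def one_shift_Aut by simp

lemma shift_automorphism_image:
  assumes "subshift A X" "f \<in> shift_automorphisms A X"
  shows "f ` X = X"
proof -
  let ?T = "subtopology (full_shift_topology A) X"
  have "f ` topspace ?T = topspace ?T"
    using assms(2) homeomorphic_imp_surjective_map unfolding shift_automorphisms_def by blast
  then show ?thesis using topspace_subshift[OF assms(1)] by simp
qed

lemma shift_automorphism_Bij:
  assumes "subshift A X" "f \<in> shift_automorphisms A X"
  shows "f \<in> Bij X"
proof -
  let ?T = "subtopology (full_shift_topology A) X"
  have "inj_on f (topspace ?T)" "f \<in> extensional X"
    using assms(2) homeomorphic_imp_injective_map unfolding shift_automorphisms_def by blast+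
  then show ?thesis
    using topspace_subshift[OF assms(1)] shift_automorphism_image[OF assms]
    by (simp add: Bij_def bij_betw_def)
qed

text \<open>The product of \<open>BijGroup\<close> is \<open>compose\<close> only on
  \<open>Bij X\<close>, hence the membership hypotheses.\<close>

lemma mult_shift_Aut:
  assumes "subshift A X" "f \<in> carrier (shift_Aut A X)" "h \<in> carrier (shift_Aut A X)"
  shows "f \<otimes>\<^bsub>shift_Aut A X\<^esub> h = compose X f h"
  using assms shift_automorphism_Bij by (auto simp: shift_Aut_def BijGroup_def)

lemma pow_shift_Aut:
  assumes sub: "subshift A X" and f: "f \<in> carrier (shift_Aut A X)" and x: "x \<in> X"
  shows "(f [^]\<^bsub>shift_Aut A X\<^esub> (n::nat)) x = (f ^^ n) x"
proof -
  interpret H: group "shift_Aut A X" by (rule group_shift_Aut[OF sub])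
  have "f ` X = X" using shift_automorphism_image[OF sub] f by (simp add: shift_Aut_def)
  then show ?thesis
    using x
  \<comment> \<open>The group power multiplies by \<open>f\<close> on the right, so the induction
    hypothesis is applied at \<open>f x\<close>.\<close>
  proof (induction n arbitrary: x)
    case 0
    then show ?case by (simp add: one_shift_Aut)
  next
    case (Suc n)
    then show ?case
      using f by (simp add: mult_shift_Aut[OF sub] compose_def funpow_swap1) blast
  qed
qed

text \<open>Each letter of a word adds at most a common range \<open>R\<close> of the images of
  generators and their inverses.\<close>

lemma hom_has_range_word_length:
  assumes "group G" "finite A" "subshift A X" and hom: "\<Phi> \<in> hom G (shift_Aut A X)"
    and S: "finite S" "S \<subseteq> carrier G"
  obtains R where "R > 0"
    "\<And>x. x \<in> generate G S \<Longrightarrow> has_range X (R * word_length G S x) (\<Phi> x)"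
proof -
  interpret group G by fact
  interpret H: group "shift_Aut A X" by (rule group_shift_Aut) fact
  interpret group_hom G "shift_Aut A X" \<Phi> by unfold_locales (rule hom)
  define T where "T = S \<union> m_inv G ` S"
  have T: "finite T" "T \<subseteq> carrier G" using S by (auto simp: T_def)
  have "\<forall>t\<in>T. \<exists>N. has_range X N (\<Phi> t)"
    using shift_automorphism_has_range[OF assms(2,3)] T hom_closed by (auto simp: shift_Aut_def)
  then obtain N where N: "\<And>t. t \<in> T \<Longrightarrow> has_range X (N t) (\<Phi> t)" by metis
  \<comment> \<open>The sum bounds all these ranges at once; \<open>Suc\<close> makes
    \<open>R\<close> positive even when all are 0.\<close>
  define R where "R = Suc (\<Sum>t\<in>T. N t)"
  have R: "has_range X R (\<Phi> t)" if "t \<in> T" for t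
    using N[OF that] member_le_sum[OF that, of N] T(1)
    by (auto simp: R_def intro: has_range_mono)
  have word: "foldr (\<otimes>\<^bsub>G\<^esub>) ws \<one>\<^bsub>G\<^esub> \<in> carrier G \<and> has_range X (R * length ws) (\<Phi> (foldr (\<otimes>\<^bsub>G\<^esub>) ws \<one>\<^bsub>G\<^esub>))"
    if "set ws \<subseteq> T" for ws
    using that
  proof (induction ws)
    case Nil
    then show ?case by (simp add: has_range_one)
  next
    case (Cons t ws)
    define v where "v = foldr (\<otimes>\<^bsub>G\<^esub>) ws \<one>\<^bsub>G\<^esub>"
    have t: "t \<in> T" "t \<in> carrier G" using Cons T by auto
    have v: "v \<in> carrier G" "has_range X (R * length ws) (\<Phi> v)" using Cons by (auto simp: v_def)
    have "\<Phi> v ` X = X"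
      using shift_automorphism_image[OF assms(3)] hom_closed[OF v(1)] by (simp add: shift_Aut_def)
    then have "\<Phi> v \<in> X \<rightarrow> X" by blast
    then have "has_range X (R + R * length ws) (compose X (\<Phi> t) (\<Phi> v))"
      using has_range_compose R t v by blast
    then show ?case using t v by (simp add: mult_shift_Aut[OF assms(3)] flip: v_def)
  qed
  show ?thesis
  proof (rule that[of R])
    fix x assume "x \<in> generate G S"
    then show "has_range X (R * word_length G S x) (\<Phi> x)"
      using word_length_representation[OF S(2)] word unfolding T_def by metis
  qed (simp add: R_def)
qed

text \<open>A column of length \<open>m\<close> involves all powers below \<open>m\<close>.
  Monotonicity of \<open>ln\<close> handles the large ones, and \<open>K\<close> absorbs the
  finitely many outside the asymptotic bound.\<close>

lemma eventually_log_bound_uniform: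
  fixes l :: "nat \<Rightarrow> nat"
  assumes "C > 0" and ev: "\<forall>\<^sub>F m in sequentially. real (l m) \<le> C * ln (real m)"
  obtains K where "K \<ge> 0" "\<And>i m. i < m \<Longrightarrow> real (l i) \<le> C * ln (real m) + K"
proof -
  obtain m0 where m0: "\<And>m. m \<ge> m0 \<Longrightarrow> real (l m) \<le> C * ln (real m)"
    using ev unfolding eventually_sequentially by blast
  define K where "K = (\<Sum>i<Suc m0. real (l i))"
  have "K \<ge> 0" by (simp add: K_def sum_nonneg)
  moreover have "real (l i) \<le> C * ln (real m) + K" if "i < m" for i m
  proof (cases "i < Suc m0")
    case True
    then have "real (l i) \<le> K" unfolding K_def by (intro member_le_sum) auto
    moreover have "0 \<le> C * ln (real m)" using that \<open>C > 0\<close> by auto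
    ultimately show ?thesis by simp
  next
    case False
    have "real (l i) \<le> C * ln (real i)" using False by (intro m0) simp
    also have "\<dots> \<le> C * ln (real m)" using False that \<open>C > 0\<close> by simp
    finally show ?thesis using \<open>K \<ge> 0\<close> by simp
  qed
  ultimately show ?thesis using that by blast
qed

text \<open>The window has length about \<open>2 * C * ln m\<close>; at a small enough growth rate
  \<open>e\<close> it has only about the square root of \<open>m\<close> possible contents, up to a
  constant factor.\<close>

lemma zero_entropy_few_columns:
  assumes "finite A" and XA: "X \<subseteq> UNIV \<rightarrow> A" and ne: "X \<noteq> {}"
    and ent: "topological_entropy X = 0" and "C > 0"
    and range: "\<And>i m. i < m \<Longrightarrow> \<exists>N. has_range X N (f ^^ i) \<and> real N \<le> C * ln (real m) + K"
  shows "\<exists>m. card (column f m ` X) < m"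
proof -
  \<comment> \<open>This choice gives \<open>2 * (C * e) = 1 / 2\<close>, half of the exponent
    available in \<open>m = exp (ln m)\<close>.\<close>
  define e where "e = 1 / (4 * C)"
  have e: "e > 0" "C * e = 1 / 4" using \<open>C > 0\<close> by (auto simp: e_def)
  define N where "N m = nat \<lceil>C * ln (real m) + K\<rceil>" for m :: nat
  have ln_top: "filterlim (\<lambda>m. ln (real m)) at_top sequentially"
    by (rule filterlim_compose[OF ln_at_top filterlim_real_sequentially])
  have Ctop: "filterlim (\<lambda>m. C * ln (real m) + K) at_top sequentially"
    using filterlim_tendsto_add_at_top[OF tendsto_const[of K]
        filterlim_tendsto_pos_mult_at_top[OF tendsto_const \<open>C > 0\<close> ln_top]]
    by (simp add: add.commute)
  obtain n0 where n0: "\<And>n. n \<ge> n0 \<Longrightarrow> real (complexity X n) \<le> exp (e * real n)"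
    using zero_entropy_complexity[OF assms(1) XA ne ent e(1)]
    unfolding eventually_sequentially by blast
  \<comment> \<open>The first condition makes the window longer than \<open>n0\<close>; the second
    lets the other half of \<open>ln m\<close> absorb the constants.\<close>
  have "\<forall>\<^sub>F m in sequentially. C * ln (real m) + K \<ge> real n0"
    using Ctop unfolding filterlim_at_top by blast
  moreover have "\<forall>\<^sub>F m in sequentially. ln (real m) > 2 * (e * (2 * K + 3))"
    using ln_top unfolding filterlim_at_top_dense by blast
  ultimately have "\<forall>\<^sub>F m in sequentially. card (column f m ` X) < m"
    using eventually_gt_at_top[of 0]
  proof eventually_elim
    case (elim m)
    \<comment> \<open>Rounding up costs 1 in the radius, whence the constant
      \<open>2 * (K + 1) + 1 = 2 * K + 3\<close>.\<close>
    have N: "real (N m) \<le> C * ln (real m) + K + 1" "C * ln (real m) + K \<le> real (N m)"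
      unfolding N_def using elim by linarith+
    have "has_range X (N m) (f ^^ i)" if i: "i < m" for i
    proof -
      obtain M where "has_range X M (f ^^ i)" "real M \<le> C * ln (real m) + K"
        using range[OF i] by blast
      moreover from this have "real M \<le> real (N m)" using N(2) by linarith
      then have "M \<le> N m" by simp
      ultimately show ?thesis using has_range_mono by blast
    qed
    then have "card (column f m ` X) \<le> complexity X (2 * N m + 1)"
      by (rule card_columns_le_complexity[OF assms(1) XA])
    then have "real (card (column f m ` X)) \<le> real (complexity X (2 * N m + 1))" by simp
    also have "\<dots> \<le> exp (e * real (2 * N m + 1))"
      using N elim by (intro n0) linarith
    also have "\<dots> \<le> exp (e * (2 * (C * ln (real m) + K + 1) + 1))"
      using N e by (simp add: mult_left_mono)
    also have "e * (2 * (C * ln (real m) + K + 1) + 1) = 2 * (C * e) * ln (real m) + e * (2 * K + 3)"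
      by (simp add: algebra_simps)
    also have "exp \<dots> < exp (ln (real m))"
      using elim unfolding e(2) exp_less_cancel_iff by linarith
    also have "\<dots> = real m" using elim by simp
    finally show ?case by simp
  qed
  then show ?thesis by (meson eventually_happens sequentially_bot)
qed

lemma distorted_image_torsion:
  assumes "finite A" and sub: "subshift A X" and ent: "topological_entropy X = 0"
    and "group G" and g: "g \<in> carrier G" and dist: "exponential_distortion G g"
    and hom: "\<Phi> \<in> hom G (shift_Aut A X)"
  shows "\<exists>p>0. \<Phi> g [^]\<^bsub>shift_Aut A X\<^esub> (p::nat) = \<one>\<^bsub>shift_Aut A X\<^esub>"
proof -
  interpret group G by fact
  interpret H: group "shift_Aut A X" by (rule group_shift_Aut[OF sub])
  interpret group_hom G "shift_Aut A X" \<Phi> by unfold_locales (rule hom)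
  define f where "f = \<Phi> g"
  have f: "f \<in> carrier (shift_Aut A X)" using g by (simp add: f_def)
  then have aut: "f \<in> shift_automorphisms A X" by (simp add: shift_Aut_def)
  have fX: "f ` X = X" by (rule shift_automorphism_image[OF sub aut])
  note XA = subshift_subset_alphabet[OF sub]
  have period: "\<exists>p>0. \<forall>x\<in>X. (f ^^ p) x 0 = x 0"
  \<comment> \<open>The entropy argument needs a point; for empty \<open>X\<close> any period serves
    vacuously.\<close>
  proof (cases "X = {}")
    case False
    obtain S C where S: "finite S" "S \<subseteq> carrier G" "g \<in> generate G S" and C: "C > 0"
      and ev: "\<forall>\<^sub>F m in sequentially. real (word_length G S (g [^]\<^bsub>G\<^esub> m)) \<le> C * ln (real m)"
      using dist unfolding exponential_distortion_def by blast
    obtain R where R: "R > 0"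
      "\<And>x. x \<in> generate G S \<Longrightarrow> has_range X (R * word_length G S x) (\<Phi> x)"
      using hom_has_range_word_length[OF assms(4,1) sub hom S(1,2)] by blast
    obtain K where K: "K \<ge> 0"
      "\<And>i m. i < m \<Longrightarrow> real (word_length G S (g [^]\<^bsub>G\<^esub> i)) \<le> C * ln (real m) + K"
      using eventually_log_bound_uniform[OF C ev] by blast
    have pow: "g [^]\<^bsub>G\<^esub> i \<in> generate G S" for i :: nat
      by (induction i) (auto intro: generate.one generate.eng S)
    have "\<exists>N. has_range X N (f ^^ i) \<and> real N \<le> real R * C * ln (real m) + real R * K"
      if "i < m" for i m
    proof (intro exI conjI)
      have "\<Phi> (g [^]\<^bsub>G\<^esub> i) x = (f ^^ i) x" if "x \<in> X" for x
        using pow_shift_Aut[OF sub f that] g by (simp add: hom_nat_pow f_def)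
      then show "has_range X (R * word_length G S (g [^]\<^bsub>G\<^esub> i)) (f ^^ i)"
        using R(2)[OF pow[of i]] has_range_cong by metis
      show "real (R * word_length G S (g [^]\<^bsub>G\<^esub> i)) \<le> real R * C * ln (real m) + real R * K"
        using mult_left_mono[OF K(2)[OF that], of "real R"] by (simp add: algebra_simps)
    qed
    then have "\<exists>m. card (column f m ` X) < m"
      using zero_entropy_few_columns[OF assms(1) XA False ent, of "real R * C" f "real R * K"] R C
      by simp
    then show ?thesis using few_columns_imp_periodic[OF assms(1) XA fX] by blast
  qed auto
  then obtain p where p: "p > 0" "\<And>x. x \<in> X \<Longrightarrow> (f ^^ p) x 0 = x 0" by blast
  define h where "h = f [^]\<^bsub>shift_Aut A X\<^esub> p"
  have h: "h \<in> shift_automorphisms A X"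
    using H.nat_pow_closed[OF f, of p] by (simp add: h_def shift_Aut_def)
  have inv: "shift ` X = X" using sub by (simp add: subshift_def)
  have com: "h (shift x) = shift (h x)" if "x \<in> X" for x
    using h that by (auto simp: shift_automorphisms_def)
  have h0: "h x 0 = x 0" if "x \<in> X" for x
    using p(2)[OF that] pow_shift_Aut[OF sub f that] by (simp add: h_def)
  \<comment> \<open>Coordinate \<open>k\<close> of \<open>x\<close> is coordinate 0 of
    \<open>translate k x\<close>, and \<open>h\<close> commutes with translations, so
    \<open>h0\<close> reaches every coordinate.\<close>
  have "h x = x" if x: "x \<in> X" for x
  proof
    fix k
    note tr = translate_mem_commute[of X h, OF inv com x, of k]
    show "h x k = x k"
      using tr h0[of "translate k x"] by (auto simp: translate_def)
  qed
  moreover have "h \<in> extensional X" using h by (auto simp: shift_automorphisms_def)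
  ultimately have "h = (\<lambda>x\<in>X. x)" by (auto simp: fun_eq_iff extensional_def)
  then show ?thesis using p(1) by (auto simp: h_def f_def one_shift_Aut)
qed

text \<open>The powers of \<open>x [^] p\<close> are distinct elements of the kernel. Being
  infinite, the kernel has finite index, and its cosets map onto the image.\<close>

lemma (in group_hom) almost_simple_image_finite:
  assumes "almost_simple G" and x: "x \<in> carrier G" "G.ord x = 0"
    and p: "p > 0" "h x [^]\<^bsub>H\<^esub> (p::nat) = \<one>\<^bsub>H\<^esub>"
  shows "finite (h ` carrier G)"
proof -
  have "\<not> finite (kernel G H h)"
  proof
    assume fin: "finite (kernel G H h)"
    have "range (\<lambda>n::nat. x [^] (p * n)) \<subseteq> kernel G H h"
    proof clarify
      fix n
      have "h (x [^] (p * n)) = (h x [^]\<^bsub>H\<^esub> p) [^]\<^bsub>H\<^esub> n"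
        using x by (simp add: hom_nat_pow H.nat_pow_pow)
      then show "x [^] (p * n) \<in> kernel G H h" using x p by (simp add: kernel_def)
    qed
    then have "\<not> inj (\<lambda>n::nat. x [^] (p * n))"
      using fin finite_imageD finite_subset infinite_UNIV_nat by metis
    then obtain i j where "i \<noteq> j" "x [^] (p * i) = x [^] (p * j)"
      unfolding inj_on_def by blast
    \<comment> \<open>With order 0, equal integer powers force 0 to divide the difference of the
      exponents, so \<open>p * i = p * j\<close>.\<close>
    then show False
      using G.int_pow_eq[OF x(1), of "int (p * i)" "int (p * j)"] x(2) p(1)
      by (simp add: int_pow_int del: of_nat_mult)
  qed
  then have fin: "finite (rcosets (kernel G H h))"
    using assms(1) normal_kernel unfolding almost_simple_def by blast
  \<comment> \<open>\<open>h\<close> collapses each coset of the kernel to one point, which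
    \<open>the_elem\<close> extracts.\<close>
  have "h ` carrier G \<subseteq> (\<lambda>C. the_elem (h ` C)) ` (rcosets (kernel G H h))"
  proof clarify
    fix y assume y: "y \<in> carrier G"
    have "h ` (kernel G H h #> y) = {h y}"
      using y by (force simp: r_coset_def kernel_def)
    then show "h y \<in> (\<lambda>C. the_elem (h ` C)) ` (rcosets (kernel G H h))"
      using y unfolding RCOSETS_def by (auto intro!: image_eqI)
  qed
  then show ?thesis using fin by (meson finite_imageI finite_subset)
qed

theorem corollary3p10:
  fixes A :: "'a set" and X :: "(int \<Rightarrow> 'a) set"
    and G :: "('g, 'm) monoid_scheme" and g :: 'g
    and \<Phi> :: "'g \<Rightarrow> ((int \<Rightarrow> 'a) \<Rightarrow> (int \<Rightarrow> 'a))"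
  assumes "finite A" and "subshift A X" and "topological_entropy X = 0"
    and "group G" and "g \<in> carrier G" and "exponential_distortion G g"
    and "\<Phi> \<in> hom G (shift_Aut A X)"
  shows "group.ord (shift_Aut A X) (\<Phi> g) \<noteq> 0 \<and>
    (almost_simple G \<longrightarrow> finite (\<Phi> ` carrier G))"
proof -
  interpret group G by fact
  interpret H: group "shift_Aut A X" by (rule group_shift_Aut) fact
  interpret group_hom G "shift_Aut A X" \<Phi> by unfold_locales fact
  obtain p :: nat where p: "p > 0" "\<Phi> g [^]\<^bsub>shift_Aut A X\<^esub> p = \<one>\<^bsub>shift_Aut A X\<^esub>"
    using distorted_image_torsion[OF assms] by blast
  \<comment> \<open>The order divides the positive \<open>p\<close>, so it is not 0, the value that
    encodes infinite order.\<close>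
  have "H.ord (\<Phi> g) \<noteq> 0"
    using H.pow_eq_id[of "\<Phi> g" p] p assms(5) by auto
  moreover have "ord g = 0" using assms(6) by (simp add: exponential_distortion_def)
  ultimately show ?thesis
    using almost_simple_image_finite p assms(5) by blast
qed

end
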